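(* Let $L$ be a finite distributive lattice. If the poset $J(L)$ is not an initial segment of a finite upper semilattice, then $L$ is not isomorphic to any interval $[\mathbf{a},\mathbf{b}]$ of the Muchnik lattice $\mathcal{M}_w$.
   Context: Mass problems are subsets of Baire space $\omega^\omega$. For mass problems $\mathcal{A},\mathcal{B}$, Muchnik reducibility is $\mathcal{A}\le_w\mathcal{B}$ iff for every $f\in\mathcal{B}$ there is $g\in\mathcal{A}$ with $g\le_T f$; $\equiv_w$ is the induced equivalence. The Muchnik lattice $\mathcal{M}_w$ is the set of $\equiv_w$-classes ordered by $\le_w$ (a distributive lattice). $[a,b]=\{x:a\le x\le b\}$. $J(L)$ is the set of nonzero join-irreducible elements of $L$, ordered as in $L$. A poset $P$ is an initial segment of a finite upper semilattice if $P$ is isomorphic to a downward closed subset of some finite partial order in which every two elements have a least upper bound. *)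

theory Defs
  imports Main
begin

section \<open>Relative computability\<close>

text \<open>Codes for the partial functions that are \<open>\<mu>\<close>-recursive in a given total function,
  whose values are returned by the code \<open>Query\<close>. Codes carry no arity; the rules below determine
  on which argument lists a code is defined.\<close>

datatype code =
    Zero
  | Succ
  | Proj nat
  | Query
  | Comp code "code list"
  | Prec code code
  | Mu code

text \<open>\<open>computes f c xs y\<close>: relative to \<open>f\<close>, the code \<open>c\<close> halts on \<open>xs\<close> with value \<open>y\<close>.
  The last rule is unbounded search: all values before the first zero must be defined.\<close>

inductive computes :: "(nat \<Rightarrow> nat) \<Rightarrow> code \<Rightarrow> nat list \<Rightarrow> nat \<Rightarrow> bool"
  for f :: "nat \<Rightarrow> nat" where
  zero: "computes f Zero xs 0"
| succ: "computes f Succ [x] (Suc x)"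
| proj: "i < length xs \<Longrightarrow> computes f (Proj i) xs (xs ! i)"
| query: "computes f Query [x] (f x)"
| comp: "list_all2 (\<lambda>c y. computes f c xs y) cs ys \<Longrightarrow> computes f d ys z
    \<Longrightarrow> computes f (Comp d cs) xs z"
| prec_0: "computes f c xs y \<Longrightarrow> computes f (Prec c d) (0 # xs) y"
| prec_Suc: "computes f (Prec c d) (n # xs) r \<Longrightarrow> computes f d (n # r # xs) y
    \<Longrightarrow> computes f (Prec c d) (Suc n # xs) y"
| mu: "computes f c (n # xs) 0 \<Longrightarrow> (\<forall>i<n. \<exists>y>0. computes f c (i # xs) y)
    \<Longrightarrow> computes f (Mu c) xs n"

inductive_cases computes_ZeroE: "computes f Zero xs y"
inductive_cases computes_SuccE: "computes f Succ xs y"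
inductive_cases computes_ProjE: "computes f (Proj i) xs y"
inductive_cases computes_QueryE: "computes f Query xs y"
inductive_cases computes_CompE: "computes f (Comp d cs) xs y"
inductive_cases computes_Prec_0E: "computes f (Prec c d) (0 # xs) y"
inductive_cases computes_Prec_SucE: "computes f (Prec c d) (Suc n # xs) y"
inductive_cases computes_MuE: "computes f (Mu c) xs y"

lemma computes_unique: "computes f c xs y \<Longrightarrow> computes f c xs z \<Longrightarrow> y = z"
proof (induction arbitrary: z rule: computes.induct)
  case (comp xs cs ys d w)
  from comp.prems obtain ys' where
    ys': "list_all2 (\<lambda>c y. computes f c xs y) cs ys'" "computes f d ys' z"
    by (rule computes_CompE)
  have "ys = ys'"
    using comp.IH(1) ys'(1) unfolding list_all2_conv_all_nth by (metis nth_equalityI)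
  with comp.IH(2) ys'(2) show ?case by blast
next
  case (prec_Suc c d n xs r y)
  from prec_Suc.prems obtain r' where
    "computes f (Prec c d) (n # xs) r'" "computes f d (n # r' # xs) z"
    by (rule computes_Prec_SucE)
  with prec_Suc.IH show ?case by blast
next
  case (mu c n xs)
  from mu.prems have z: "computes f c (z # xs) 0" "\<forall>i<z. \<exists>y>0. computes f c (i # xs) y"
    by (rule computes_MuE; simp)+
  have "\<not> n < z" using z(2) mu.IH(1) by fastforce
  moreover have "\<not> z < n" using z(1) mu.IH(2) by fastforce
  ultimately show ?case by simp
next
  case (zero xs)
  then show ?case by (auto elim: computes_ZeroE)
next
  case (succ x)
  then show ?case by (auto elim: computes_SuccE)
next
  case (proj i xs)
  then show ?case by (auto elim: computes_ProjE)
next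
  case (query x)
  then show ?case by (auto elim: computes_QueryE)
next
  case (prec_0 c xs y d)
  from prec_0.prems have "computes f c xs z" by (rule computes_Prec_0E)
  then show ?case by (rule prec_0.IH)
qed

definition turing_le :: "(nat \<Rightarrow> nat) \<Rightarrow> (nat \<Rightarrow> nat) \<Rightarrow> bool"  (infix \<open>\<le>\<^sub>T\<close> 50) where
  "g \<le>\<^sub>T f \<longleftrightarrow> (\<exists>c. \<forall>x. computes f c [x] (g x))"

lemma turing_le_refl: "f \<le>\<^sub>T f"
  unfolding turing_le_def using computes.query by blast

primrec replace_query :: "code \<Rightarrow> code \<Rightarrow> code" where
  "replace_query d Zero = Zero"
| "replace_query d Succ = Succ"
| "replace_query d (Proj i) = Proj i"
| "replace_query d Query = d"
| "replace_query d (Comp c cs) = Comp (replace_query d c) (map (replace_query d) cs)"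
| "replace_query d (Prec c e) = Prec (replace_query d c) (replace_query d e)"
| "replace_query d (Mu c) = Mu (replace_query d c)"

lemma computes_replace_query:
  assumes d: "\<And>x. computes f d [x] (g x)"
  shows "computes g c xs y \<Longrightarrow> computes f (replace_query d c) xs y"
proof (induction rule: computes.induct)
  case (comp xs cs ys c z)
  have "list_all2 (\<lambda>c y. computes f c xs y) (map (replace_query d) cs) ys"
    using comp.IH(1) by (auto simp: list_all2_conv_all_nth)
  with comp.IH(2) show ?case by (auto intro: computes.comp)
next
  case (mu c n xs)
  then show ?case by (auto intro!: computes.mu)
next
  case (prec_Suc c e n xs r y)
  from prec_Suc.IH show ?case unfolding replace_query.simps by (rule computes.prec_Suc)
qed (simp_all add: computes.zero computes.succ computes.proj computes.prec_0 d)

lemma turing_le_trans: "g \<le>\<^sub>T f \<Longrightarrow> f \<le>\<^sub>T h \<Longrightarrow> g \<le>\<^sub>T h"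
proof -
  assume "g \<le>\<^sub>T f" "f \<le>\<^sub>T h"
  then obtain c d where "\<And>x. computes f c [x] (g x)" and "\<And>x. computes h d [x] (f x)"
    unfolding turing_le_def by blast
  then have "computes h (replace_query d c) [x] (g x)" for x
    by (intro computes_replace_query)
  then show "g \<le>\<^sub>T h" unfolding turing_le_def by blast
qed

definition turing_join :: "(nat \<Rightarrow> nat) \<Rightarrow> (nat \<Rightarrow> nat) \<Rightarrow> nat \<Rightarrow> nat"  (infixl \<open>\<oplus>\<^sub>T\<close> 65) where
  "f \<oplus>\<^sub>T g = (\<lambda>n. if even n then f (n div 2) else g (n div 2))"

lemma computes_comp1:
  "computes f c xs y \<Longrightarrow> computes f d [y] z \<Longrightarrow> computes f (Comp d [c]) xs z"
  by (rule computes.comp[where ys = "[y]"]) auto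

lemma computes_comp2:
  "computes f c xs y \<Longrightarrow> computes f c' xs y' \<Longrightarrow> computes f d [y, y'] z
    \<Longrightarrow> computes f (Comp d [c, c']) xs z"
  by (rule computes.comp[where ys = "[y, y']"]) auto

lemma computes_comp3:
  "computes f c xs y \<Longrightarrow> computes f c' xs y' \<Longrightarrow> computes f c'' xs y''
    \<Longrightarrow> computes f d [y, y', y''] z \<Longrightarrow> computes f (Comp d [c, c', c'']) xs z"
  by (rule computes.comp[where ys = "[y, y', y'']"]) auto

lemma computes_proj: "i < length xs \<Longrightarrow> y = xs ! i \<Longrightarrow> computes f (Proj i) xs y"
  using computes.proj by simp

definition add_code :: code where
  "add_code = Prec (Proj 0) (Comp Succ [Proj 1])"

lemma computes_add: "computes f add_code [m, n] (m + n)"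
  unfolding add_code_def
proof (induction m)
  case 0
  show ?case by (auto intro!: computes.prec_0 computes_proj)
next
  case (Suc m)
  have "computes f (Comp Succ [Proj 1]) [m, m + n, n] (Suc (m + n))"
    by (auto intro!: computes_comp1[where y = "m + n"] computes_proj computes.succ)
  with Suc show ?case by (auto intro: computes.prec_Suc)
qed

definition parity_code :: code where
  "parity_code = Prec Zero (Comp (Prec (Comp Succ [Zero]) Zero) [Proj 1])"

lemma computes_parity: "computes f parity_code [n] (n mod 2)"
  unfolding parity_code_def
proof (induction n)
  case 0
  show ?case by (auto intro!: computes.prec_0 computes.zero)
next
  case (Suc n)
  have neg: "computes f (Prec (Comp Succ [Zero]) Zero) [b] (1 - b)" for b
  proof (induction b)
    case 0
    have "computes f (Comp Succ [Zero]) [] (Suc 0)"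
      by (rule computes_comp1[OF computes.zero computes.succ])
    then show ?case by (auto intro: computes.prec_0)
  next
    case (Suc b)
    then show ?case by (auto intro: computes.prec_Suc computes.zero)
  qed
  have "computes f (Comp (Prec (Comp Succ [Zero]) Zero) [Proj 1]) [n, n mod 2] (1 - n mod 2)"
    by (rule computes_comp1[OF _ neg]) (auto intro: computes_proj)
  moreover have "1 - n mod 2 = Suc n mod 2" by presburger
  ultimately show ?case using Suc by (auto intro: computes.prec_Suc)
qed

definition half_code :: code where
  "half_code = Prec Zero (Comp add_code [Comp parity_code [Proj 0], Proj 1])"

lemma computes_half: "computes f half_code [n] (n div 2)"
  unfolding half_code_def
proof (induction n)
  case 0
  show ?case by (auto intro!: computes.prec_0 computes.zero)
next
  case (Suc n)
  have "computes f (Comp add_code [Comp parity_code [Proj 0], Proj 1]) [n, n div 2]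
      (n mod 2 + n div 2)"
    by (rule computes_comp2[OF computes_comp1[OF _ computes_parity] _ computes_add])
      (auto intro: computes_proj)
  moreover have "n mod 2 + n div 2 = Suc n div 2" by presburger
  ultimately show ?case using Suc by (auto intro: computes.prec_Suc)
qed

definition if_code :: code where
  "if_code = Prec (Proj 0) (Proj 3)"

lemma computes_if: "computes f if_code [b, x, y] (if b = 0 then x else y)"
  unfolding if_code_def
proof (induction b)
  case 0
  show ?case by (auto intro!: computes.prec_0 computes_proj)
next
  case (Suc b)
  then show ?case by (auto intro!: computes.prec_Suc computes_proj split: if_splits)
qed

lemma turing_le_join1: "f \<le>\<^sub>T f \<oplus>\<^sub>T g"
proof -
  have "computes (f \<oplus>\<^sub>T g) (Comp Query [Comp add_code [Proj 0, Proj 0]]) [x] (f x)" for x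
  proof -
    have "computes (f \<oplus>\<^sub>T g) (Comp add_code [Proj 0, Proj 0]) [x] (x + x)"
      by (rule computes_comp2[OF _ _ computes_add]) (auto intro: computes_proj)
    moreover have "(f \<oplus>\<^sub>T g) (x + x) = f x"
      by (simp add: turing_join_def flip: mult_2)
    ultimately show ?thesis by (metis computes_comp1 computes.query)
  qed
  then show ?thesis unfolding turing_le_def by blast
qed

lemma turing_le_join2: "g \<le>\<^sub>T f \<oplus>\<^sub>T g"
proof -
  have "computes (f \<oplus>\<^sub>T g) (Comp Query [Comp Succ [Comp add_code [Proj 0, Proj 0]]]) [x] (g x)"
    for x
  proof -
    have "computes (f \<oplus>\<^sub>T g) (Comp add_code [Proj 0, Proj 0]) [x] (x + x)"
      by (rule computes_comp2[OF _ _ computes_add]) (auto intro: computes_proj)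
    moreover have "(f \<oplus>\<^sub>T g) (Suc (x + x)) = g x"
      by (simp add: turing_join_def flip: mult_2)
    ultimately show ?thesis by (metis computes_comp1 computes.query computes.succ)
  qed
  then show ?thesis unfolding turing_le_def by blast
qed

lemma turing_join_least:
  assumes "f \<le>\<^sub>T h" "g \<le>\<^sub>T h"
  shows "f \<oplus>\<^sub>T g \<le>\<^sub>T h"
proof -
  obtain c d where c: "\<And>x. computes h c [x] (f x)" and d: "\<And>x. computes h d [x] (g x)"
    using assms unfolding turing_le_def by blast
  have "computes h (Comp if_code [parity_code, Comp c [half_code], Comp d [half_code]]) [x]
      (if x mod 2 = 0 then f (x div 2) else g (x div 2))" for x
    by (intro computes_comp3[OF computes_parity _ _ computes_if] computes_comp1[OF computes_half] c d)
  then have "computes h (Comp if_code [parity_code, Comp c [half_code], Comp d [half_code]]) [x]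
      ((f \<oplus>\<^sub>T g) x)" for x
    by (simp only: turing_join_def even_iff_mod_2_eq_zero)
  then show ?thesis unfolding turing_le_def by blast
qed


section \<open>The Muchnik lattice\<close>

definition muchnik_le :: "(nat \<Rightarrow> nat) set \<Rightarrow> (nat \<Rightarrow> nat) set \<Rightarrow> bool"  (infix \<open>\<le>\<^sub>w\<close> 50) where
  "A \<le>\<^sub>w B \<longleftrightarrow> (\<forall>f\<in>B. \<exists>g\<in>A. g \<le>\<^sub>T f)"

definition muchnik_equiv :: "(nat \<Rightarrow> nat) set \<Rightarrow> (nat \<Rightarrow> nat) set \<Rightarrow> bool"  (infix \<open>\<equiv>\<^sub>w\<close> 50) where
  "A \<equiv>\<^sub>w B \<longleftrightarrow> A \<le>\<^sub>w B \<and> B \<le>\<^sub>w A"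

lemma muchnik_le_refl: "A \<le>\<^sub>w A"
  unfolding muchnik_le_def using turing_le_refl by blast

lemma muchnik_le_trans: "A \<le>\<^sub>w B \<Longrightarrow> B \<le>\<^sub>w C \<Longrightarrow> A \<le>\<^sub>w C"
  unfolding muchnik_le_def using turing_le_trans by meson

quotient_type muchnik = "(nat \<Rightarrow> nat) set" / muchnik_equiv
  by (rule equivpI)
    (auto simp: reflp_def symp_def transp_def muchnik_equiv_def
      intro: muchnik_le_refl muchnik_le_trans)

instantiation muchnik :: distrib_lattice
begin

lift_definition less_eq_muchnik :: "muchnik \<Rightarrow> muchnik \<Rightarrow> bool" is muchnik_le
  unfolding muchnik_equiv_def using muchnik_le_trans by blast

definition less_muchnik :: "muchnik \<Rightarrow> muchnik \<Rightarrow> bool" where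
  "less_muchnik a b \<longleftrightarrow> a \<le> b \<and> \<not> b \<le> a"

lift_definition inf_muchnik :: "muchnik \<Rightarrow> muchnik \<Rightarrow> muchnik" is "(\<union>)"
  unfolding muchnik_equiv_def muchnik_le_def by (meson Un_iff)

lift_definition sup_muchnik :: "muchnik \<Rightarrow> muchnik \<Rightarrow> muchnik"
  is "\<lambda>A B. {f \<oplus>\<^sub>T g | f g. f \<in> A \<and> g \<in> B}"
proof -
  have "{f \<oplus>\<^sub>T g | f g. f \<in> A \<and> g \<in> B} \<le>\<^sub>w {f \<oplus>\<^sub>T g | f g. f \<in> A' \<and> g \<in> B'}"
    if "A \<le>\<^sub>w A'" "B \<le>\<^sub>w B'" for A A' B B'
    unfolding muchnik_le_def
  proof
    fix h assume "h \<in> {f \<oplus>\<^sub>T g | f g. f \<in> A' \<and> g \<in> B'}"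
    then obtain f g where h: "h = f \<oplus>\<^sub>T g" "f \<in> A'" "g \<in> B'" by blast
    then obtain f' g' where "f' \<in> A" "g' \<in> B" "f' \<le>\<^sub>T f" "g' \<le>\<^sub>T g"
      using \<open>A \<le>\<^sub>w A'\<close> \<open>B \<le>\<^sub>w B'\<close> unfolding muchnik_le_def by blast
    moreover from this have "f' \<oplus>\<^sub>T g' \<le>\<^sub>T h"
      unfolding h by (meson turing_join_least turing_le_join1 turing_le_join2 turing_le_trans)
    ultimately show "\<exists>k\<in>{f \<oplus>\<^sub>T g | f g. f \<in> A \<and> g \<in> B}. k \<le>\<^sub>T h" by blast
  qed
  then show "{f \<oplus>\<^sub>T g | f g. f \<in> A \<and> g \<in> B} \<equiv>\<^sub>w {f \<oplus>\<^sub>T g | f g. f \<in> A' \<and> g \<in> B'}"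
    if "A \<equiv>\<^sub>w A'" "B \<equiv>\<^sub>w B'" for A A' B B'
    using that unfolding muchnik_equiv_def by presburger
qed

instance
proof
  fix x y z :: muchnik
  show "x < y \<longleftrightarrow> x \<le> y \<and> \<not> y \<le> x" by (rule less_muchnik_def)
  show "x \<le> x" by transfer (rule muchnik_le_refl)
  show "x \<le> y \<Longrightarrow> y \<le> z \<Longrightarrow> x \<le> z" by transfer (rule muchnik_le_trans)
  show "x \<le> y \<Longrightarrow> y \<le> x \<Longrightarrow> x = y" by transfer (simp add: muchnik_equiv_def)
  show "inf x y \<le> x" by transfer (auto simp: muchnik_le_def intro: turing_le_refl)
  show "inf x y \<le> y" by transfer (auto simp: muchnik_le_def intro: turing_le_refl)
  show "x \<le> y \<Longrightarrow> x \<le> z \<Longrightarrow> x \<le> inf y z" by transfer (auto simp: muchnik_le_def)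
  show "x \<le> sup x y" by transfer (auto simp: muchnik_le_def intro: turing_le_join1)
  show "y \<le> sup x y" by transfer (auto simp: muchnik_le_def intro: turing_le_join2)
  show "y \<le> x \<Longrightarrow> z \<le> x \<Longrightarrow> sup y z \<le> x"
    by transfer (simp add: muchnik_le_def, blast intro: turing_join_least)
  show "sup x (inf y z) = inf (sup x y) (sup x z)"
  proof transfer
    fix A B C :: "(nat \<Rightarrow> nat) set"
    have "{f \<oplus>\<^sub>T g | f g. f \<in> A \<and> g \<in> B \<union> C}
        = {f \<oplus>\<^sub>T g | f g. f \<in> A \<and> g \<in> B} \<union> {f \<oplus>\<^sub>T g | f g. f \<in> A \<and> g \<in> C}" by blast
    then show "{f \<oplus>\<^sub>T g | f g. f \<in> A \<and> g \<in> B \<union> C}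
        \<equiv>\<^sub>w {f \<oplus>\<^sub>T g | f g. f \<in> A \<and> g \<in> B} \<union> {f \<oplus>\<^sub>T g | f g. f \<in> A \<and> g \<in> C}"
      by (simp add: muchnik_equiv_def muchnik_le_refl)
  qed
qed

end


section \<open>Finite posets\<close>

definition order_isomorphic ::
    "'a set \<Rightarrow> ('a \<Rightarrow> 'a \<Rightarrow> bool) \<Rightarrow> 'b set \<Rightarrow> ('b \<Rightarrow> 'b \<Rightarrow> bool) \<Rightarrow> bool" where
  "order_isomorphic A le B le' \<longleftrightarrow>
    (\<exists>h. bij_betw h A B \<and> (\<forall>x\<in>A. \<forall>y\<in>A. le x y \<longleftrightarrow> le' (h x) (h y)))"

text \<open>A finite lattice type has a least element without being an instance of a class that names
  it, so "nonzero" is expressed as not being least.\<close>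

definition join_irreducibles :: "'a::lattice set" where
  "join_irreducibles =
    {x. \<not> (\<forall>y. x \<le> y) \<and> (\<forall>y z. x = sup y z \<longrightarrow> x = y \<or> x = z)}"

definition finite_upper_semilattice :: "'a set \<Rightarrow> ('a \<Rightarrow> 'a \<Rightarrow> bool) \<Rightarrow> bool" where
  "finite_upper_semilattice U le \<longleftrightarrow>
    finite U \<and> reflp_on U le \<and> transp_on U le \<and> antisymp_on U le \<and>
    (\<forall>x\<in>U. \<forall>y\<in>U. \<exists>z\<in>U. le x z \<and> le y z \<and> (\<forall>w\<in>U. le x w \<and> le y w \<longrightarrow> le z w))"

definition downward_closed :: "'a set \<Rightarrow> 'a set \<Rightarrow> ('a \<Rightarrow> 'a \<Rightarrow> bool) \<Rightarrow> bool" where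
  "downward_closed D U le \<longleftrightarrow> D \<subseteq> U \<and> (\<forall>x\<in>D. \<forall>y\<in>U. le y x \<longrightarrow> y \<in> D)"

text \<open>Taking the carrier of the semilattice inside \<open>nat\<close> loses nothing, since the carrier is
  finite; the lemma below gives the version with a carrier in an arbitrary type.\<close>

definition initial_segment_of_finite_usl :: "'a set \<Rightarrow> ('a \<Rightarrow> 'a \<Rightarrow> bool) \<Rightarrow> bool" where
  "initial_segment_of_finite_usl P le \<longleftrightarrow>
    (\<exists>(U :: nat set) le' D. finite_upper_semilattice U le' \<and> downward_closed D U le' \<and>
      order_isomorphic P le D le')"

lemma initial_segment_of_finite_uslI:
  fixes U :: "'b set"
  assumes usl: "finite_upper_semilattice U le'" and D: "downward_closed D U le'"
    and iso: "order_isomorphic P le D le'"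
  shows "initial_segment_of_finite_usl P le"
proof -
  have "finite U" using usl by (simp add: finite_upper_semilattice_def)
  then obtain e :: "'b \<Rightarrow> nat" where e: "inj_on e U"
    using finite_imp_inj_to_nat_seg by blast
  define r where "r m n = le' (inv_into U e m) (inv_into U e n)" for m n
  have r: "r (e x) (e y) \<longleftrightarrow> le' x y" if "x \<in> U" "y \<in> U" for x y
    using that e by (simp add: r_def)
  have DU: "D \<subseteq> U" using D by (simp add: downward_closed_def)
  have "finite_upper_semilattice (e ` U) r"
    unfolding finite_upper_semilattice_def
  proof (intro conjI ballI)
    show "finite (e ` U)" using \<open>finite U\<close> by simp
    show "reflp_on (e ` U) r"
      using usl by (auto simp: finite_upper_semilattice_def r intro!: reflp_onI dest: reflp_onD)
    show "transp_on (e ` U) r"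
      using usl by (auto simp: finite_upper_semilattice_def r intro!: transp_onI dest: transp_onD)
    show "antisymp_on (e ` U) r"
      using usl by (auto simp: finite_upper_semilattice_def r intro!: antisymp_onI dest: antisymp_onD)
    fix m n assume "m \<in> e ` U" "n \<in> e ` U"
    then obtain x y where xy: "m = e x" "x \<in> U" "n = e y" "y \<in> U" by blast
    have "\<forall>x\<in>U. \<forall>y\<in>U. \<exists>z\<in>U. le' x z \<and> le' y z \<and> (\<forall>w\<in>U. le' x w \<and> le' y w \<longrightarrow> le' z w)"
      using usl unfolding finite_upper_semilattice_def by (elim conjE)
    from this[rule_format, OF xy(2,4)]
    obtain z where "z \<in> U" "le' x z" "le' y z" "\<forall>w\<in>U. le' x w \<and> le' y w \<longrightarrow> le' z w"
      by (elim bexE conjE)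
    with xy show "\<exists>k\<in>e ` U. r m k \<and> r n k \<and> (\<forall>w\<in>e ` U. r m w \<and> r n w \<longrightarrow> r k w)"
      by (intro bexI[where x = "e z"]) (auto simp: r)
  qed
  moreover have "downward_closed (e ` D) (e ` U) r"
    unfolding downward_closed_def
  proof (intro conjI ballI impI)
    show "e ` D \<subseteq> e ` U" using DU by (rule image_mono)
    fix m n assume "m \<in> e ` D" "n \<in> e ` U" "r n m"
    then obtain x y where xy: "m = e x" "x \<in> D" "n = e y" "y \<in> U" by blast
    with \<open>r n m\<close> DU have "le' y x" by (auto simp: r)
    with xy D show "n \<in> e ` D" unfolding downward_closed_def by blast
  qed
  moreover have "order_isomorphic P le (e ` D) r"
  proof -
    obtain h where h: "bij_betw h P D" "\<And>x y. x \<in> P \<Longrightarrow> y \<in> P \<Longrightarrow> le x y \<longleftrightarrow> le' (h x) (h y)"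
      using iso unfolding order_isomorphic_def by blast
    have "bij_betw (e \<circ> h) P (e ` D)"
      using h(1) e DU by (meson bij_betw_trans inj_on_imp_bij_betw inj_on_subset)
    moreover have "le x y \<longleftrightarrow> r ((e \<circ> h) x) ((e \<circ> h) y)" if "x \<in> P" "y \<in> P" for x y
      using that h DU r by (metis bij_betwE comp_apply subsetD)
    ultimately show ?thesis unfolding order_isomorphic_def by blast
  qed
  ultimately show ?thesis unfolding initial_segment_of_finite_usl_def by blast
qed

end

theory Submission
  imports Defs
begin

text \<open>A Muchnik degree amounts to a \<open>\<le>\<^sub>T\<close>-upward closed mass problem, and the order becomes reverse
  inclusion. Hence an interval from \<open>A\<close> to \<open>B\<close> is the lattice of upward closed sets between \<open>B\<close> and
  \<open>A\<close>; when it is finite, its join-irreducibles are exactly the elements \<open>j f\<close>, for \<open>f \<in> A - B\<close>,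
  given by the largest such set avoiding \<open>f\<close>, and \<open>j f \<le> j g\<close> iff \<open>f \<le>\<^sub>T g\<close>. If \<open>f\<close> and \<open>g\<close> lie
  below some \<open>h\<close> in \<open>A - B\<close>, then their Turing join is again in \<open>A - B\<close>. So any two bounded
  join-irreducibles have a least upper bound among the join-irreducibles, and adding one top element
  gives the required upper semilattice.\<close>

definition turing_upclosed :: "(nat \<Rightarrow> nat) set \<Rightarrow> bool" where
  "turing_upclosed X \<longleftrightarrow> (\<forall>f\<in>X. \<forall>g. f \<le>\<^sub>T g \<longrightarrow> g \<in> X)"

text \<open>The upward closure of a mass problem is the largest member of its class, hence a
  canonical representative.\<close>

lift_definition muchnik_cone :: "muchnik \<Rightarrow> (nat \<Rightarrow> nat) set"
  is "\<lambda>A. {f. \<exists>g\<in>A. g \<le>\<^sub>T f}"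
  unfolding muchnik_equiv_def muchnik_le_def by (blast intro: turing_le_trans)

lemma muchnik_le_iff_cone: "a \<le> b \<longleftrightarrow> muchnik_cone b \<subseteq> muchnik_cone a"
  by transfer (auto simp: muchnik_le_def intro: turing_le_refl turing_le_trans)

lemma turing_upclosed_cone: "turing_upclosed (muchnik_cone a)"
  unfolding turing_upclosed_def by transfer (auto intro: turing_le_trans)

lemma turing_upclosed_obtain_cone:
  assumes "turing_upclosed X"
  obtains a where "muchnik_cone a = X"
proof
  show "muchnik_cone (abs_muchnik X) = X"
    using assms unfolding muchnik_cone.abs_eq turing_upclosed_def
    by (blast intro: turing_le_refl)
qed

lemma initial_segment_of_finite_usl_bounded_joins:
  fixes P :: "'a::order set"
  assumes fin: "finite P"
    and lub: "\<And>x y u. \<lbrakk>x \<in> P; y \<in> P; u \<in> P; x \<le> u; y \<le> u\<rbrakk>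
      \<Longrightarrow> \<exists>z\<in>P. x \<le> z \<and> y \<le> z \<and> (\<forall>w\<in>P. x \<le> w \<and> y \<le> w \<longrightarrow> z \<le> w)"
  shows "initial_segment_of_finite_usl P (\<le>)"
proof (rule initial_segment_of_finite_uslI)
  define le :: "'a option \<Rightarrow> 'a option \<Rightarrow> bool" where
    "le x y \<longleftrightarrow> y = None \<or> (\<exists>u v. x = Some u \<and> y = Some v \<and> u \<le> v)" for x y
  let ?U = "insert None (Some ` P)"
  show "finite_upper_semilattice ?U le"
    unfolding finite_upper_semilattice_def
  proof (intro conjI ballI)
    show "finite ?U" using fin by simp
    show "reflp_on ?U le" by (auto simp: le_def intro!: reflp_onI)
    show "transp_on ?U le" by (auto simp: le_def intro!: transp_onI)
    show "antisymp_on ?U le" by (auto simp: le_def intro!: antisymp_onI)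
    fix p q assume pq: "p \<in> ?U" "q \<in> ?U"
    show "\<exists>z\<in>?U. le p z \<and> le q z \<and> (\<forall>w\<in>?U. le p w \<and> le q w \<longrightarrow> le z w)"
    proof (cases "\<exists>w\<in>Some ` P. le p w \<and> le q w")
      case True
      then obtain x y u where "p = Some x" "q = Some y" "u \<in> P" "x \<le> u" "y \<le> u"
        by (auto simp: le_def)
      with pq lub[of x y u] obtain z where "z \<in> P" "x \<le> z" "y \<le> z"
        "\<forall>w\<in>P. x \<le> w \<and> y \<le> w \<longrightarrow> z \<le> w" by auto
      with \<open>p = Some x\<close> \<open>q = Some y\<close> show ?thesis
        by (intro bexI[where x = "Some z"]) (auto simp: le_def)
    next
      case False
      then show ?thesis by (intro bexI[where x = None]) (auto simp: le_def)
    qed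
  qed
  show "downward_closed (Some ` P) ?U le"
    by (auto simp: downward_closed_def le_def)
  show "order_isomorphic P (\<le>) (Some ` P) le"
    unfolding order_isomorphic_def
    by (rule exI[where x = Some]) (auto simp: le_def bij_betw_def)
qed

text \<open>Split off one element of \<open>T\<close>: irreducibility makes the join equal either to
  that element or to the join of the rest, where induction applies.\<close>

lemma join_irreducible_Sup_fin_mem:
  assumes "finite T" "T \<noteq> {}" "Sup_fin T \<in> join_irreducibles"
  shows "Sup_fin T \<in> T"
  using assms
proof (induction rule: finite_ne_induct)
  case (insert t T)
  then have eq: "Sup_fin (insert t T) = sup t (Sup_fin T)" by simp
  then have "Sup_fin (insert t T) = t \<or> Sup_fin (insert t T) = Sup_fin T"
    using insert.prems unfolding join_irreducibles_def by blast
  with insert show ?case by auto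
qed simp

theorem theorem3p11:
  assumes "\<not> initial_segment_of_finite_usl
             (join_irreducibles :: 'a::{finite, distrib_lattice} set) (\<le>)"
  shows "\<not> (\<exists>a b :: muchnik. order_isomorphic (UNIV :: 'a set) (\<le>) {a..b} (\<le>))"
proof
  assume "\<exists>a b :: muchnik. order_isomorphic (UNIV :: 'a set) (\<le>) {a..b} (\<le>)"
  then obtain a b and h :: "'a \<Rightarrow> muchnik" where h: "bij_betw h UNIV {a..b}"
    and h_le: "\<And>x y. x \<le> y \<longleftrightarrow> h x \<le> h y"
    unfolding order_isomorphic_def by blast
  define A B where "A = muchnik_cone a" and "B = muchnik_cone b"
  define S where "S x = muchnik_cone (h x)" for x
  have S_le: "x \<le> y \<longleftrightarrow> S y \<subseteq> S x" for x y
    by (simp add: h_le muchnik_le_iff_cone S_def)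
  have "h x \<in> {a..b}" for x using h by (auto simp: bij_betw_def)
  then have S_bounds: "B \<subseteq> S x" "S x \<subseteq> A" for x
    by (auto simp: A_def B_def S_def simp flip: muchnik_le_iff_cone)
  have up: "turing_upclosed A" "turing_upclosed B" "turing_upclosed (S x)" for x
    by (simp_all add: A_def B_def S_def turing_upclosed_cone)
  have S_surj: "\<exists>x. S x = X" if X: "turing_upclosed X" "B \<subseteq> X" "X \<subseteq> A" for X
  proof -
    obtain c where c: "muchnik_cone c = X" using X(1) by (rule turing_upclosed_obtain_cone)
    then have "c \<in> {a..b}" using X by (simp add: muchnik_le_iff_cone A_def B_def)
    then obtain x where "h x = c" using h by (metis bij_betw_imp_surj_on imageE)
    with c show ?thesis by (auto simp: S_def)
  qed
  have BA: "B \<subseteq> A" using S_bounds by blast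
  \<comment> \<open>Upward closure of the second part: anything computing a function not computable
    from \<open>f\<close> is itself not computable from \<open>f\<close>.\<close>
  have "\<exists>x. S x = B \<union> {g\<in>A. \<not> g \<le>\<^sub>T f}" for f
  proof (rule S_surj)
    show "turing_upclosed (B \<union> {g \<in> A. \<not> g \<le>\<^sub>T f})"
      using up(1,2) unfolding turing_upclosed_def by (blast intro: turing_le_trans)
  qed (use BA in auto)
  then obtain j where S_j: "\<And>f. S (j f) = B \<union> {g\<in>A. \<not> g \<le>\<^sub>T f}" by metis
  have j_le: "j f \<le> x \<longleftrightarrow> f \<notin> S x" if f: "f \<in> A - B" for f x
  proof
    assume "j f \<le> x"
    then show "f \<notin> S x" using f S_j[of f] turing_le_refl[of f] unfolding S_le by auto
  next
    assume "f \<notin> S x"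
    moreover have "g \<le>\<^sub>T f \<Longrightarrow> g \<in> S x \<Longrightarrow> f \<in> S x" for g
      using up(3)[of x] unfolding turing_upclosed_def by blast
    ultimately show "j f \<le> x" using S_bounds(2)[of x] unfolding S_le S_j by auto
  qed
  have j_le_j: "j f \<le> j g \<longleftrightarrow> f \<le>\<^sub>T g" if "f \<in> A - B" for f g
    using that by (auto simp: j_le S_j)
  have j_irr: "j f \<in> join_irreducibles" if f: "f \<in> A - B" for f
    unfolding join_irreducibles_def
  proof (intro CollectI conjI allI impI notI)
    assume least: "\<forall>y. j f \<le> y"
    \<comment> \<open>This \<open>y\<close> is the bottom; \<open>j f\<close> below it would force
      \<open>f\<close> out of \<open>A\<close>.\<close>
    obtain y where "S y = A" using S_surj[OF up(1) BA] by blast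
    with least f show False by (metis DiffD1 j_le)
  next
    fix y z assume eq: "j f = sup y z"
    \<comment> \<open>The intersection corresponds to the join of \<open>y\<close> and
      \<open>z\<close>, and a function missing from it is missing from \<open>S y\<close> or from
      \<open>S z\<close>.\<close>
    have "turing_upclosed (S y \<inter> S z)"
      using up(3) unfolding turing_upclosed_def by blast
    then obtain w where w: "S w = S y \<inter> S z"
      using S_surj S_bounds by (metis le_infI le_infI1)
    then have "y \<le> w" "z \<le> w" by (simp_all add: S_le)
    then have "j f \<le> w" unfolding eq by (rule sup_least)
    then have "f \<notin> S y \<or> f \<notin> S z" using f w by (auto simp: j_le)
    then have "j f \<le> y \<or> j f \<le> z" using f by (simp add: j_le)
    then show "j f = y \<or> j f = z" unfolding eq by (auto intro: antisym)
  qed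
  have j_surj: "\<exists>f\<in>A - B. x = j f" if x: "x \<in> join_irreducibles" for x
  proof -
    let ?F = "A - S x"
    have FAB: "?F \<subseteq> A - B" using S_bounds by blast
    \<comment> \<open>Such a \<open>y\<close> has \<open>S y\<close> disjoint from
      \<open>A - S x\<close>, so \<open>S y\<close> lies inside \<open>S x\<close>. Thus
      \<open>x\<close> is the join of the \<open>j f\<close> with \<open>f\<close> in
      \<open>?F\<close>, a finite join since the lattice is finite.\<close>
    have least: "x \<le> y" if "\<And>f. f \<in> ?F \<Longrightarrow> j f \<le> y" for y
      using that FAB S_bounds(2)[of y] unfolding S_le[of x] by (auto simp: j_le subset_iff)
    have ne: "?F \<noteq> {}"
    proof
      assume "?F = {}"
      then have "\<forall>y. x \<le> y" using least by blast
      then show False using x by (simp add: join_irreducibles_def)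
    qed
    have fin: "finite (j ` ?F)" by (rule finite_subset[OF subset_UNIV finite])
    have "Sup_fin (j ` ?F) = x"
    proof (rule antisym)
      show "Sup_fin (j ` ?F) \<le> x"
        by (rule Sup_fin.boundedI[OF fin]) (use ne FAB in \<open>auto simp: j_le\<close>)
      show "x \<le> Sup_fin (j ` ?F)" by (rule least) (simp add: Sup_fin.coboundedI fin)
    qed
    then have "x \<in> j ` ?F" using join_irreducible_Sup_fin_mem[OF fin] ne x by auto
    with FAB show ?thesis by blast
  qed
  have "initial_segment_of_finite_usl (join_irreducibles :: 'a set) (\<le>)"
  proof (rule initial_segment_of_finite_usl_bounded_joins)
    fix x y u :: 'a
    assume "x \<in> join_irreducibles" "y \<in> join_irreducibles" "u \<in> join_irreducibles"
      and le: "x \<le> u" "y \<le> u"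
    then obtain f g k where f: "f \<in> A - B" "x = j f" and g: "g \<in> A - B" "y = j g"
      and k: "k \<in> A - B" "u = j k" using j_surj by meson
    have "f \<oplus>\<^sub>T g \<le>\<^sub>T k" using le f g k by (simp add: j_le_j turing_join_least)
    \<comment> \<open>The join is in \<open>A\<close> because it computes \<open>f\<close>; were it
      in \<open>B\<close>, then \<open>k\<close>, which computes it, would be too.\<close>
    then have fg: "f \<oplus>\<^sub>T g \<in> A - B"
      using f(1) k(1) up(1,2) turing_le_join1[of f g] unfolding turing_upclosed_def by blast
    show "\<exists>z\<in>join_irreducibles. x \<le> z \<and> y \<le> z \<and>
        (\<forall>w\<in>join_irreducibles. x \<le> w \<and> y \<le> w \<longrightarrow> z \<le> w)"
    proof (intro bexI[where x = "j (f \<oplus>\<^sub>T g)"] conjI ballI impI)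
      show "x \<le> j (f \<oplus>\<^sub>T g)" "y \<le> j (f \<oplus>\<^sub>T g)"
        using f g by (simp_all add: j_le_j turing_le_join1 turing_le_join2)
      fix w assume "w \<in> join_irreducibles" "x \<le> w \<and> y \<le> w"
      moreover from this obtain l where "w = j l" using j_surj by blast
      ultimately show "j (f \<oplus>\<^sub>T g) \<le> w" using f g fg by (simp add: j_le_j turing_join_least)
    qed (rule j_irr[OF fg])
  qed simp
  with assms show False by contradiction
qed

end
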